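(* Let $t$, $v$, $k$, $\lambda$ and $s$ be positive integers such that $t < k < v$ and $s \leq \lfloor\frac{t}{2}\rfloor$. Let $b_{2s},b_{2s-1},\ldots,b_s$ be positive integers such that (i) $L_\lambda(v-2s,k-2s,t-2s) \leq b_{2s} \leq C_\lambda(v-2s,k-2s,t-2s)$; (ii) $\left\lceil \frac{v-i}{k-i}\, b_{i+1} \right\rceil \leq b_i \leq C_\lambda(v-i,k-i,t-i)$ for $i = 2s-1,2s-2,\ldots,s$; and (iii) $a_j \geq 0$ for $j \in \{0,\ldots,s\}$, where $a_j=\sum_{i=0}^j (-1)^{i+j}\binom{j}{i}b_{2s-i}$. Let $d=b_s\left(\binom{k}{s}-1\right)-\sum_{i=0}^{s-1}\binom{s}{i}\binom{v-s}{s-i}b_{2s-i}$. Suppose that $d < a_s$. Then \[C_{\lambda}(v,k,t) \geq \left\lceil\frac{\binom{v}{s}(b_s+1)}{\binom{k}{s}+1}\right\rceil.\]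
   Context: An incidence structure is a pair $(V,\mathcal{B})$ where $V$ is a (finite) set of points and $\mathcal{B}$ is a multiset of subsets of $V$ called blocks (numbers of blocks are counted with multiplicity). For positive integers $t,v,k,\lambda$ with $t \leq k \leq v$, a $t$-$(v,k,\lambda)$ covering is an incidence structure $(V,\mathcal{B})$ such that $|V|=v$, $|B|=k$ for all $B\in\mathcal{B}$, and each $t$-subset of $V$ is contained in at least $\lambda$ blocks in $\mathcal{B}$. The covering number $C_\lambda(v,k,t)$ is the minimum number of blocks in any $t$-$(v,k,\lambda)$ covering; by convention $C_\lambda(v,k,0)=\lambda$ for all $v,k,\lambda$. For $t\ge 1$, \[L_{\lambda}(v,k,t) = \left\lceil\frac{v}{k} \left\lceil\frac{v-1}{k-1} \cdots \left\lceil\frac{v-t+2}{k-t+2} \left\lceil\frac{\lambda(v-t+1)}{k-t+1} \right\rceil \right\rceil \cdots \right\rceil \right\rceil\] (the Schönheim bound), and $L_\lambda(v,k,0)=\lambda$. *)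

theory Defs
  imports Complex_Main "HOL-Library.Multiset"
begin

definition incidence_structure :: "'a set \<Rightarrow> 'a set multiset \<Rightarrow> bool" where
  "incidence_structure V \<B> \<longleftrightarrow> finite V \<and> (\<forall>B \<in># \<B>. B \<subseteq> V)"

definition is_covering ::
    "nat \<Rightarrow> nat \<Rightarrow> nat \<Rightarrow> nat \<Rightarrow> 'a set \<Rightarrow> 'a set multiset \<Rightarrow> bool" where
  "is_covering t v k lam V \<B> \<longleftrightarrow>
     incidence_structure V \<B> \<and> card V = v \<and> (\<forall>B \<in># \<B>. card B = k) \<and>
     (\<forall>T. T \<subseteq> V \<and> card T = t \<longrightarrow> lam \<le> size (filter_mset (\<lambda>B. T \<subseteq> B) \<B>))"

text \<open>The covering number \<open>C\<^sub>\<lambda>(v,k,t)\<close> is \<open>covering_number lam v k t\<close>.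
  Points may be taken to be natural numbers, since being a covering is invariant under
  relabelling the points and the point set is finite. The value is meaningful
  for \<open>t = 0\<close> and for \<open>0 < t \<le> k \<le> v\<close>; in the latter case the minimum is attained, because
  \<open>lam\<close> copies of each \<open>k\<close>-subset form a covering.\<close>

definition covering_number :: "nat \<Rightarrow> nat \<Rightarrow> nat \<Rightarrow> nat \<Rightarrow> nat" where
  "covering_number lam v k t =
     (if t = 0 then lam
      else (LEAST n. \<exists>(V :: nat set) \<B>. is_covering t v k lam V \<B> \<and> size \<B> = n))"

text \<open>The Schoenheim bound \<open>L\<^sub>\<lambda>(v,k,t)\<close>, by recursion from the outermost ceiling inwards.
  The innermost step multiplies \<open>L\<^sub>\<lambda>(v-t,k-t,0) = lam\<close> by \<open>(v-t+1)/(k-t+1)\<close>. For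
  \<open>t \<le> k \<le> v\<close> no subtraction truncates and no denominator vanishes.\<close>

fun schonheim_bound :: "nat \<Rightarrow> nat \<Rightarrow> nat \<Rightarrow> nat \<Rightarrow> nat" where
  "schonheim_bound lam v k 0 = lam"
| "schonheim_bound lam v k (Suc t) =
     nat \<lceil>real v / real k * real (schonheim_bound lam (v - 1) (k - 1) t)\<rceil>"

end

theory Submission
  imports Defs
begin

text \<open>
  The argument is a Fisher-type rank bound for the \<open>s\<close>-sets of smallest degree, followed by double
  counting. Take an optimal covering, with \<open>C\<close> blocks, and call the number of blocks that contain a
  set \<open>X\<close> its degree. Removing an \<open>i\<close>-set \<open>X\<close> from the blocks that contain it leaves a
  covering with parameters \<open>t - i\<close>, \<open>v - i\<close>, \<open>k - i\<close>, so every \<open>i\<close>-set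
  with \<open>s \<le> i \<le> 2s\<close> has degree at least \<open>b i\<close>
  (\<open>covering_number_le_block_degree\<close>).

  Let \<open>F\<close> be the family of the \<open>s\<close>-sets whose degree is exactly \<open>b s\<close>. If \<open>|F| \<le> C\<close>, then,
  since all other \<open>s\<close>-sets have degree at least \<open>b s + 1\<close>, counting the pairs of an \<open>s\<close>-set and
  a block containing it gives
  \<open>C * (k choose s) \<ge> (v choose s) * (b s + 1) - |F| \<ge> (v choose s) * (b s + 1) - C\<close>,
  which is the claimed bound.

  To see that \<open>|F| \<le> C\<close>, let \<open>N\<close> be the incidence matrix of \<open>F\<close> against the blocks. The
  Gram matrix \<open>M\<close> of its rows has the degree of \<open>S \<union> S'\<close> as its entry at \<open>(S, S')\<close>, and
  its rank is at most \<open>C\<close>; so it suffices that \<open>M\<close> is positive definite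
  (\<open>card_le_size_of_positive_definite\<close>). Split \<open>M = P + E\<close>, where \<open>P\<close> holds the lower bound
  \<open>b (2s - |S \<inter> S'|)\<close> for each entry.

  \<^item> The \<open>a j\<close> are the iterated differences of \<open>i \<mapsto> b (2s - i)\<close> at \<open>0\<close>, so binomial inversion expands \<open>P\<close>
    as the sum of \<open>a j\<close> times the matrix with entries \<open>|S \<inter> S'| choose j\<close>. That matrix is
    the Gram matrix of the incidence between \<open>F\<close> and the \<open>j\<close>-sets, hence positive
    semidefinite, and it is the identity for \<open>j = s\<close>. As all \<open>a j\<close> are nonnegative, \<open>P\<close> is at
    least \<open>a s\<close> times the identity (\<open>intersection_gram_form_lower_bound\<close>).

  \<^item> \<open>E\<close> is symmetric with nonnegative entries. Extended over all \<open>s\<close>-sets \<open>S'\<close>, each of its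
    rows sums to exactly \<open>d\<close>, so its rows within \<open>F\<close> sum to at most \<open>d\<close> and its
    eigenvalues are at least \<open>- d\<close> (\<open>nonneg_symmetric_form_lower_bound\<close>).

  Hence \<open>M\<close> is at least \<open>a s - d > 0\<close> times the identity.
\<close>

section \<open>Coverings and derived coverings\<close>

definition block_degree :: "'a set multiset \<Rightarrow> 'a set \<Rightarrow> nat" where
  "block_degree \<B> X = size {#B \<in># \<B>. X \<subseteq> B#}"

abbreviation subsets_of_size :: "'a set \<Rightarrow> nat \<Rightarrow> 'a set set" where
  "subsets_of_size V s \<equiv> {S. S \<subseteq> V \<and> card S = s}"

lemma finite_subsets_of_size: "finite V \<Longrightarrow> finite (subsets_of_size V s)"
  by (rule finite_subset[of _ "Pow V"]) auto

text \<open>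
  The family of all \<open>k\<close>-subsets, each taken \<open>lam\<close> times, is a covering. Without this
  the least number of blocks would be a minimum over the empty set and say nothing.\<close>

lemma covering_exists:
  assumes "0 < t" "t \<le> k" "k \<le> v"
  shows "\<exists>(V :: nat set) \<B>. is_covering t v k lam V \<B>"
proof -
  define V where "V = {..<v}"
  define \<B> where "\<B> = repeat_mset lam (mset_set (subsets_of_size V k))"
  have fin: "finite (subsets_of_size V k)"
    by (rule finite_subsets_of_size) (simp add: V_def)
  have blocks: "B \<subseteq> V \<and> card B = k" if "B \<in># \<B>" for B
  proof -
    have "count \<B> B \<noteq> 0" using that by simp
    thus ?thesis using fin by (auto simp: \<B>_def count_mset_set' split: if_splits)
  qed
  have "lam \<le> size {#B \<in># \<B>. T \<subseteq> B#}" if T: "T \<subseteq> V" "card T = t" for T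
  proof -
    obtain B where B: "T \<subseteq> B" "B \<subseteq> V" "card B = k"
      using exists_subset_between[of T k V] T assms by (auto simp: V_def)
    have "count {#B \<in># \<B>. T \<subseteq> B#} B = lam"
      using B fin by (simp add: \<B>_def)
    thus ?thesis using count_le_size[of "{#B \<in># \<B>. T \<subseteq> B#}" B] by linarith
  qed
  hence "is_covering t v k lam V \<B>"
    using blocks by (auto simp: is_covering_def incidence_structure_def V_def)
  thus ?thesis by blast
qed

lemma covering_number_le_size:
  fixes V :: "nat set"
  assumes "0 < t" "is_covering t v k lam V \<B>"
  shows "covering_number lam v k t \<le> size \<B>"
proof -
  have "(LEAST n. \<exists>(V :: nat set) \<B>. is_covering t v k lam V \<B> \<and> size \<B> = n) \<le> size \<B>"
    by (rule Least_le) (use assms in blast)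
  thus ?thesis using assms(1) by (simp add: covering_number_def)
qed

lemma covering_number_attained:
  assumes "0 < t" "t \<le> k" "k \<le> v"
  obtains V :: "nat set" and \<B> where
    "is_covering t v k lam V \<B>" "size \<B> = covering_number lam v k t"
proof -
  have "\<exists>n. \<exists>(V :: nat set) \<B>. is_covering t v k lam V \<B> \<and> size \<B> = n"
    using covering_exists[OF assms] by blast
  from LeastI_ex[OF this] show ?thesis
    using that assms by (auto simp: covering_number_def)
qed

text \<open>
  The blocks through \<open>X\<close>, with \<open>X\<close> removed, cover each \<open>(t - i)\<close>-set \<open>T\<close> outside \<open>X\<close> as often as
  the original blocks cover the \<open>t\<close>-set \<open>T \<union> X\<close>. For \<open>i = t\<close> the covering number is \<open>lam\<close> by
  convention, and the inequality is the covering property itself.\<close>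

lemma covering_number_le_block_degree:
  fixes V :: "nat set"
  assumes cov: "is_covering t v k lam V \<B>" and X: "X \<subseteq> V" "card X = i" and "i \<le> t"
  shows "covering_number lam (v - i) (k - i) (t - i) \<le> block_degree \<B> X"
proof (cases "i = t")
  case True
  thus ?thesis using cov X
    by (auto simp: covering_number_def block_degree_def is_covering_def)
next
  case False
  have finV: "finite V" and cardV: "card V = v"
    using cov by (auto simp: is_covering_def incidence_structure_def)
  have finX: "finite X" using X finV finite_subset by blast
  have blk: "B \<subseteq> V" "card B = k" if "B \<in># \<B>" for B
    using cov that by (auto simp: is_covering_def incidence_structure_def)
  have lam_le: "lam \<le> size {#B \<in># \<B>. Y \<subseteq> B#}" if "Y \<subseteq> V" "card Y = t" for Y
    using cov that by (simp add: is_covering_def)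
  define \<D> where "\<D> = image_mset (\<lambda>B. B - X) {#B \<in># \<B>. X \<subseteq> B#}"
  have "lam \<le> size {#D \<in># \<D>. T \<subseteq> D#}" if T: "T \<subseteq> V - X" "card T = t - i" for T
  proof -
    have "finite T" using T finV by (meson finite_Diff finite_subset)
    hence "card (T \<union> X) = t"
      using T X finX False \<open>i \<le> t\<close> by (subst card_Un_disjoint) auto
    hence "lam \<le> size {#B \<in># \<B>. T \<union> X \<subseteq> B#}"
      using T X by (intro lam_le) auto
    also have "{#B \<in># \<B>. T \<union> X \<subseteq> B#} = {#B \<in># {#B \<in># \<B>. X \<subseteq> B#}. T \<subseteq> B - X#}"
      unfolding filter_filter_mset
      by (rule filter_mset_cong) (use T in auto)
    finally show ?thesis by (simp add: \<D>_def filter_mset_image_mset)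
  qed
  moreover have "card (B - X) = k - i" if "B \<in># \<B>" "X \<subseteq> B" for B
    using that blk X finX by (simp add: card_Diff_subset)
  ultimately have "is_covering (t - i) (v - i) (k - i) lam (V - X) \<D>"
    using blk X finX finV cardV
    by (auto simp: is_covering_def incidence_structure_def \<D>_def card_Diff_subset)
  hence "covering_number lam (v - i) (k - i) (t - i) \<le> size \<D>"
    using False \<open>i \<le> t\<close> by (intro covering_number_le_size) auto
  thus ?thesis by (simp add: \<D>_def block_degree_def)
qed

section \<open>Counting subsets and blocks\<close>

text \<open>
  Double counting: a block that contains \<open>S\<close> contains \<open>S \<union> S'\<close> for exactly \<open>k choose s\<close> of the \<open>S'\<close>,
  and any other block for none. The case \<open>S = {}\<close> counts all incidences between \<open>s\<close>-sets
  and blocks.\<close>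

lemma sum_block_degree_Un:
  assumes "finite V" and blocks: "\<And>B. B \<in># \<B> \<Longrightarrow> B \<subseteq> V \<and> card B = k"
  shows "(\<Sum>S'\<in>subsets_of_size V s. block_degree \<B> (S \<union> S')) = block_degree \<B> S * (k choose s)"
  using blocks
proof (induction \<B>)
  case empty
  thus ?case by (simp add: block_degree_def)
next
  case (add B \<B>)
  have fin: "finite (subsets_of_size V s)"
    using \<open>finite V\<close> by (rule finite_subsets_of_size)
  have B: "B \<subseteq> V" "card B = k" using add.prems by auto
  hence "finite B" using assms finite_subset by blast
  have step: "block_degree (add_mset B \<B>) X = of_bool (X \<subseteq> B) + block_degree \<B> X" for X
    by (simp add: block_degree_def)
  have "(\<Sum>S'\<in>subsets_of_size V s. of_bool (S \<union> S' \<subseteq> B)) =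
        card {S' \<in> subsets_of_size V s. S \<union> S' \<subseteq> B}"
    using fin by (simp add: of_bool_def sum.If_cases Int_def)
  also have "{S' \<in> subsets_of_size V s. S \<union> S' \<subseteq> B} =
        (if S \<subseteq> B then subsets_of_size B s else {})"
    using B by auto
  also have "card \<dots> = of_bool (S \<subseteq> B) * (k choose s)"
    using n_subsets[OF \<open>finite B\<close>, of s] B by simp
  finally show ?case using add
    by (simp add: step sum.distrib algebra_simps)
qed

text \<open>
  A set \<open>S'\<close> is determined by its part inside \<open>S\<close> and its part outside, which can be chosen
  independently.\<close>

lemma card_subsets_meeting:
  assumes "finite V" "S \<subseteq> V" "i \<le> s"
  shows "card {S' \<in> subsets_of_size V s. card (S \<inter> S') = i} =
           (card S choose i) * ((card V - card S) choose (s - i))"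
proof -
  have finS: "finite S" "finite (V - S)" using assms finite_subset by auto
  let ?P = "subsets_of_size S i \<times> subsets_of_size (V - S) (s - i)"
  have "bij_betw (\<lambda>(I, J). I \<union> J) ?P {S' \<in> subsets_of_size V s. card (S \<inter> S') = i}"
  proof (rule bij_betw_byWitness[where f' = "\<lambda>S'. (S \<inter> S', S' - S)"])
    show "\<forall>p\<in>?P. (S \<inter> (case p of (I, J) \<Rightarrow> I \<union> J), (case p of (I, J) \<Rightarrow> I \<union> J) - S) = p"
      by auto
    show "\<forall>S'\<in>{S' \<in> subsets_of_size V s. card (S \<inter> S') = i}.
            (case (S \<inter> S', S' - S) of (I, J) \<Rightarrow> I \<union> J) = S'"
      by auto
    show "(\<lambda>(I, J). I \<union> J) ` ?P \<subseteq> {S' \<in> subsets_of_size V s. card (S \<inter> S') = i}"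
    proof clarsimp
      fix I J assume *: "I \<subseteq> S" "i = card I" "J \<subseteq> V - S" "card J = s - card I"
      have "finite I" "finite J" using * finS by (auto intro: finite_subset)
      hence "card (I \<union> J) = s" using * assms by (subst card_Un_disjoint) auto
      moreover have "S \<inter> (I \<union> J) = I" using * by auto
      ultimately show "I \<subseteq> V \<and> J \<subseteq> V \<and> card (I \<union> J) = s \<and> card (S \<inter> (I \<union> J)) = card I"
        using * assms by auto
    qed
    show "(\<lambda>S'. (S \<inter> S', S' - S)) ` {S' \<in> subsets_of_size V s. card (S \<inter> S') = i} \<subseteq> ?P"
      using finS by (auto simp: card_Diff_subset_Int Int_commute)
  qed
  hence "card {S' \<in> subsets_of_size V s. card (S \<inter> S') = i} = card ?P"
    by (rule bij_betw_same_card [symmetric])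
  also have "\<dots> = (card S choose i) * ((card V - card S) choose (s - i))"
    using assms(2) finS(1)
    by (simp only: card_cartesian_product n_subsets[OF finS(1)] n_subsets[OF finS(2)] card_Diff_subset)
  finally show ?thesis .
qed

section \<open>Binomial inversion\<close>

text \<open>
  By \<open>(i choose j) * (j choose l) = (i choose l) * ((i - l) choose (j - l))\<close> this is a multiple of the
  alternating sum of a row of Pascal's triangle, which vanishes except in row \<open>0\<close>.\<close>

lemma alternating_binomial_orthogonality:
  assumes "l \<le> i"
  shows "(\<Sum>j\<le>i. (-1) ^ (l + j) * int (i choose j) * int (j choose l)) = of_bool (l = i)"
proof -
  have "(\<Sum>j\<le>i. (-1) ^ (l + j) * int (i choose j) * int (j choose l)) =
        (\<Sum>j=l..i. (-1) ^ (l + j) * int (i choose j) * int (j choose l))"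
    by (rule sum.mono_neutral_right) auto
  also have "\<dots> = (\<Sum>m\<le>i - l. int (i choose l) * ((-1) ^ m * int ((i - l) choose m)))"
  proof (rule sum.reindex_bij_witness[of _ "\<lambda>m. l + m" "\<lambda>j. j - l"])
    fix j assume j: "j \<in> {l..i}"
    have "int (i choose j) * int (j choose l) = int (i choose l) * int ((i - l) choose (j - l))"
      using choose_mult[of l j i] j by (metis atLeastAtMost_iff of_nat_mult)
    moreover have "(-1 :: int) ^ (l + j) = (-1) ^ (j - l)"
      using j by (auto simp: minus_one_power_iff)
    ultimately show "int (i choose l) * ((- 1) ^ (j - l) * int (i - l choose (j - l))) =
        (- 1) ^ (l + j) * int (i choose j) * int (j choose l)"
      by (simp add: algebra_simps)
  qed (use assms in auto)
  also have "\<dots> = of_bool (l = i)"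
    using choose_alternating_sum[of "i - l", where 'a = int] assms
    by (cases "l = i") (simp_all add: sum_distrib_left [symmetric])
  finally show ?thesis .
qed

lemma binomial_inversion:
  fixes f g :: "nat \<Rightarrow> int"
  assumes "\<And>j. j \<le> i \<Longrightarrow> g j = (\<Sum>l=0..j. (-1) ^ (l + j) * int (j choose l) * f l)"
  shows "f i = (\<Sum>j\<le>i. int (i choose j) * g j)"
proof -
  have "(\<Sum>j\<le>i. int (i choose j) * g j) =
        (\<Sum>j\<le>i. \<Sum>l\<le>i. f l * ((-1) ^ (l + j) * int (i choose j) * int (j choose l)))"
  proof (rule sum.cong[OF refl])
    fix j assume "j \<in> {..i}"
    hence "g j = (\<Sum>l\<le>i. (-1) ^ (l + j) * int (j choose l) * f l)"
      using assms by (auto intro!: sum.mono_neutral_left)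
    thus "int (i choose j) * g j =
        (\<Sum>l\<le>i. f l * ((-1) ^ (l + j) * int (i choose j) * int (j choose l)))"
      by (simp add: sum_distrib_left algebra_simps)
  qed
  also have "\<dots> = (\<Sum>l\<le>i. f l * (\<Sum>j\<le>i. (-1) ^ (l + j) * int (i choose j) * int (j choose l)))"
    by (subst sum.swap) (simp add: sum_distrib_left)
  also have "\<dots> = (\<Sum>l\<le>i. f l * of_bool (l = i))"
    by (intro sum.cong refl) (simp add: alternating_binomial_orthogonality)
  also have "\<dots> = f i" by (simp add: of_bool_def if_distrib cong: if_cong)
  finally show ?thesis by simp
qed

section \<open>A rank bound from positive definiteness\<close>

text \<open>
  Gaussian elimination: a nonzero coefficient of one equation is used to eliminate its unknown \<open>p\<close>
  from the others, and the value of \<open>p\<close> is recovered at the end by solving that equation.\<close>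

lemma underdetermined_homogeneous_system:
  fixes f :: "'b \<Rightarrow> 'a \<Rightarrow> real"
  assumes "finite J" "finite A" "card J < card A"
  shows "\<exists>c. (\<exists>x\<in>A. c x \<noteq> 0) \<and> (\<forall>j\<in>J. (\<Sum>x\<in>A. f j x * c x) = 0)"
  using assms
proof (induction J arbitrary: A f rule: finite_induct)
  case empty
  hence "A \<noteq> {}" by auto
  thus ?case by (auto intro!: exI[of _ "\<lambda>_. 1"])
next
  case (insert n J)
  show ?case
  proof (cases "\<forall>x\<in>A. f n x = 0")
    case True
    have "\<exists>c. (\<exists>x\<in>A. c x \<noteq> 0) \<and> (\<forall>j\<in>J. (\<Sum>x\<in>A. f j x * c x) = 0)"
      using insert by auto
    thus ?thesis using True by auto
  next
    case False
    then obtain p where p: "p \<in> A" "f n p \<noteq> 0" by blast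
    define A' where "A' = A - {p}"
    have A': "finite A'" "A = insert p A'" "p \<notin> A'" "card J < card A'"
      using insert p by (auto simp: A'_def)
    obtain c where c: "\<exists>x\<in>A'. c x \<noteq> 0"
        "\<And>j. j \<in> J \<Longrightarrow> (\<Sum>x\<in>A'. (f j x - f j p * f n x / f n p) * c x) = 0"
      using insert.IH[OF A'(1,4), of "\<lambda>j x. f j x - f j p * f n x / f n p"] by auto
    define c' where "c' = c(p := - (\<Sum>x\<in>A'. f n x * c x) / f n p)"
    have c'_p: "c' p = - (\<Sum>x\<in>A'. f n x * c x) / f n p" by (simp add: c'_def)
    have c'_A': "(\<Sum>x\<in>A'. h x * c' x) = (\<Sum>x\<in>A'. h x * c x)" for h
      by (rule sum.cong) (use A' in \<open>auto simp: c'_def\<close>)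
    have "(\<Sum>x\<in>A. f j x * c' x) = 0" if "j \<in> insert n J" for j
    proof (cases "j = n")
      case True
      thus ?thesis using p A' by (simp add: c'_A' c'_p)
    next
      case False
      hence "(\<Sum>x\<in>A'. f j x * c x) - f j p / f n p * (\<Sum>x\<in>A'. f n x * c x) = 0"
        using c(2)[of j] that
        by (simp add: sum_distrib_left sum_subtractf [symmetric] algebra_simps)
      thus ?thesis using A' by (simp add: c'_A' c'_p)
    qed
    moreover have "\<exists>x\<in>A. c' x \<noteq> 0" using c(1) A' by (auto simp: c'_def)
    ultimately show ?thesis by blast
  qed
qed

text \<open>
  The matrix of degrees of unions is the Gram matrix of the rows of the incidence matrix between
  \<open>F\<close> and the blocks, because a block contains \<open>S \<union> S'\<close> iff it contains both sets.\<close>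

lemma block_gram_form:
  fixes c :: "'a set \<Rightarrow> real"
  assumes "finite F"
  shows "(\<Sum>S\<in>F. \<Sum>S'\<in>F. c S * c S' * block_degree \<B> (S \<union> S')) =
         (\<Sum>B\<in>#\<B>. (\<Sum>S\<in>F. of_bool (S \<subseteq> B) * c S)\<^sup>2)"
proof (induction \<B>)
  case empty
  show ?case by (simp add: block_degree_def)
next
  case (add B \<B>)
  have step: "block_degree (add_mset B \<B>) X = of_bool (X \<subseteq> B) + block_degree \<B> X" for X
    by (simp add: block_degree_def)
  have "(\<Sum>S\<in>F. of_bool (S \<subseteq> B) * c S)\<^sup>2 =
        (\<Sum>S\<in>F. \<Sum>S'\<in>F. c S * c S' * of_bool (S \<union> S' \<subseteq> B))"
    by (simp add: power2_eq_square sum_product of_bool_conj mult_ac)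
  thus ?case using add by (simp add: step sum.distrib distrib_left)
qed

text \<open>
  If \<open>F\<close> had more members than there are blocks, some nonzero weighting of \<open>F\<close> would
  have total weight \<open>0\<close> inside every block, and the form would vanish there.\<close>

lemma card_le_size_of_positive_definite:
  assumes "finite F"
    and pos: "\<And>c :: 'a set \<Rightarrow> real. \<exists>S\<in>F. c S \<noteq> 0 \<Longrightarrow>
       0 < (\<Sum>S\<in>F. \<Sum>S'\<in>F. c S * c S' * block_degree \<B> (S \<union> S'))"
  shows "card F \<le> size \<B>"
proof (rule ccontr)
  assume "\<not> card F \<le> size \<B>"
  moreover have "card (set_mset \<B>) \<le> size \<B>"
    by (induction \<B>) (auto simp: card_insert_if)
  ultimately have "card (set_mset \<B>) < card F" by linarith
  then obtain c :: "'a set \<Rightarrow> real" where c: "\<exists>S\<in>F. c S \<noteq> 0"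
      "\<forall>B\<in>#\<B>. (\<Sum>S\<in>F. of_bool (S \<subseteq> B) * c S) = 0"
    using underdetermined_homogeneous_system[of "set_mset \<B>" F "\<lambda>B S. of_bool (S \<subseteq> B)"]
      assms(1) by auto
  have "(\<Sum>B\<in>#\<B>. (\<Sum>S\<in>F. of_bool (S \<subseteq> B) * c S)\<^sup>2) = (\<Sum>B\<in>#\<B>. 0)"
    by (intro arg_cong[where f = sum_mset] image_mset_cong) (use c in auto)
  with pos[OF c(1)] show False by (simp add: block_gram_form[OF assms(1)])
qed

section \<open>Lower bounds for the two parts of the Gram form\<close>

text \<open>
  The number \<open>card (S \<inter> S') choose j\<close> counts the \<open>j\<close>-sets contained in both \<open>S\<close> and \<open>S'\<close>, so each
  \<open>j\<close> contributes \<open>w j\<close> times a sum of squares. For \<open>j = s\<close> it is \<open>1\<close> on the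
  diagonal and \<open>0\<close> elsewhere, so that term alone is the left-hand side and the others can be
  dropped.\<close>

lemma intersection_gram_form_lower_bound:
  fixes c :: "'a set \<Rightarrow> real" and w :: "nat \<Rightarrow> real"
  assumes "finite F" and F: "\<And>S. S \<in> F \<Longrightarrow> finite S \<and> card S = s"
    and w: "\<And>j. j \<le> s \<Longrightarrow> 0 \<le> w j"
  shows "w s * (\<Sum>S\<in>F. (c S)\<^sup>2) \<le>
    (\<Sum>S\<in>F. \<Sum>S'\<in>F. c S * c S' * (\<Sum>j\<le>s. real (card (S \<inter> S') choose j) * w j))"
proof -
  define G where "G j = (\<Sum>S\<in>F. \<Sum>S'\<in>F. c S * c S' * real (card (S \<inter> S') choose j))" for j
  define U where "U = \<Union>F"
  have "finite U" using assms by (auto simp: U_def)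
  have G_nonneg: "0 \<le> G j" for j
  proof -
    have fin: "finite (subsets_of_size U j)"
      using \<open>finite U\<close> by (rule finite_subsets_of_size)
    have choose: "real (card (S \<inter> S') choose j) =
        (\<Sum>I\<in>subsets_of_size U j. of_bool (I \<subseteq> S) * of_bool (I \<subseteq> S'))"
      if "S \<in> F" "S' \<in> F" for S S'
    proof -
      have "finite (S \<inter> S')" using that F by auto
      hence "card (S \<inter> S') choose j = card (subsets_of_size (S \<inter> S') j)"
        by (rule n_subsets [symmetric])
      also have "subsets_of_size (S \<inter> S') j = {I \<in> subsets_of_size U j. I \<subseteq> S \<and> I \<subseteq> S'}"
        using that by (auto simp: U_def)
      finally show ?thesis
        using fin by (simp add: sum_of_bool_eq Int_def flip: of_bool_conj)
    qed
    have "G j = (\<Sum>S\<in>F. \<Sum>S'\<in>F. \<Sum>I\<in>subsets_of_size U j.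
                   (of_bool (I \<subseteq> S) * c S) * (of_bool (I \<subseteq> S') * c S'))"
      unfolding G_def by (intro sum.cong refl) (simp add: choose sum_distrib_left mult_ac)
    also have "\<dots> = (\<Sum>S\<in>F. \<Sum>I\<in>subsets_of_size U j. \<Sum>S'\<in>F.
                   (of_bool (I \<subseteq> S) * c S) * (of_bool (I \<subseteq> S') * c S'))"
      by (intro sum.cong refl sum.swap)
    also have "\<dots> = (\<Sum>I\<in>subsets_of_size U j. \<Sum>S\<in>F. \<Sum>S'\<in>F.
                   (of_bool (I \<subseteq> S) * c S) * (of_bool (I \<subseteq> S') * c S'))"
      by (rule sum.swap)
    also have "\<dots> = (\<Sum>I\<in>subsets_of_size U j. (\<Sum>S\<in>F. of_bool (I \<subseteq> S) * c S)\<^sup>2)"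
      by (simp add: power2_eq_square sum_product)
    finally show ?thesis by (simp add: sum_nonneg)
  qed
  have G_s: "G s = (\<Sum>S\<in>F. (c S)\<^sup>2)"
    unfolding G_def
  proof (rule sum.cong[OF refl])
    fix S assume S: "S \<in> F"
    have "card (S \<inter> S') choose s = of_bool (S' = S)" if "S' \<in> F" for S'
    proof (cases "S' = S")
      case False
      have "S \<inter> S' \<subset> S"
        using F[OF S] F[OF that] False by (metis card_subset_eq inf.absorb_iff1 inf_le1 psubsetI)
      hence "card (S \<inter> S') < s" using F[OF S] psubset_card_mono by blast
      thus ?thesis using False by simp
    qed (use F[OF S] in auto)
    hence "(\<Sum>S'\<in>F. c S * c S' * real (card (S \<inter> S') choose s)) =
           (\<Sum>S'\<in>F. if S' = S then c S * c S' else 0)"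
      by (intro sum.cong) auto
    thus "(\<Sum>S'\<in>F. c S * c S' * real (card (S \<inter> S') choose s)) = (c S)\<^sup>2"
      using S assms(1) by (simp add: power2_eq_square)
  qed
  have "w s * G s \<le> (\<Sum>j\<le>s. w j * G j)"
    by (rule member_le_sum) (use w G_nonneg in auto)
  also have "\<dots> = (\<Sum>j\<le>s. \<Sum>S\<in>F. \<Sum>S'\<in>F. c S * c S' * (real (card (S \<inter> S') choose j) * w j))"
    by (simp add: G_def sum_distrib_left mult_ac)
  also have "\<dots> = (\<Sum>S\<in>F. \<Sum>j\<le>s. \<Sum>S'\<in>F. c S * c S' * (real (card (S \<inter> S') choose j) * w j))"
    by (rule sum.swap)
  also have "\<dots> = (\<Sum>S\<in>F. \<Sum>S'\<in>F. \<Sum>j\<le>s. c S * c S' * (real (card (S \<inter> S') choose j) * w j))"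
    by (intro sum.cong refl sum.swap)
  finally show ?thesis by (simp add: G_s sum_distrib_left)
qed

text \<open>
  The pointwise inequality \<open>x * y \<ge> - (x\<^sup>2 + y\<^sup>2) / 2\<close> bounds the form from below by
  minus the average of two sums of squares weighted by \<open>E\<close>; by symmetry they agree, and the row
  sums bound them.\<close>

lemma nonneg_symmetric_form_lower_bound:
  fixes E :: "'a \<Rightarrow> 'a \<Rightarrow> real" and c :: "'a \<Rightarrow> real"
  assumes sym: "\<And>x y. x \<in> F \<Longrightarrow> y \<in> F \<Longrightarrow> E x y = E y x"
    and nonneg: "\<And>x y. x \<in> F \<Longrightarrow> y \<in> F \<Longrightarrow> 0 \<le> E x y"
    and row: "\<And>x. x \<in> F \<Longrightarrow> (\<Sum>y\<in>F. E x y) \<le> d"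
  shows "- d * (\<Sum>x\<in>F. (c x)\<^sup>2) \<le> (\<Sum>x\<in>F. \<Sum>y\<in>F. c x * c y * E x y)"
proof -
  let ?R = "\<Sum>x\<in>F. \<Sum>y\<in>F. (c x)\<^sup>2 * E x y"
  have "(\<Sum>x\<in>F. \<Sum>y\<in>F. (c y)\<^sup>2 * E x y) = (\<Sum>y\<in>F. \<Sum>x\<in>F. (c y)\<^sup>2 * E x y)"
    by (rule sum.swap)
  also have "\<dots> = ?R" by (intro sum.cong refl) (simp add: sym)
  finally have "- ?R = - (1/2) * (?R + (\<Sum>x\<in>F. \<Sum>y\<in>F. (c y)\<^sup>2 * E x y))" by simp
  also have "\<dots> = (\<Sum>x\<in>F. \<Sum>y\<in>F. - (1/2) * ((c x)\<^sup>2 * E x y + (c y)\<^sup>2 * E x y))"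
    by (simp only: sum_distrib_left sum.distrib distrib_left)
  also have "\<dots> = (\<Sum>x\<in>F. \<Sum>y\<in>F. - (((c x)\<^sup>2 + (c y)\<^sup>2) / 2) * E x y)"
    by (simp add: field_simps)
  also have "\<dots> \<le> (\<Sum>x\<in>F. \<Sum>y\<in>F. c x * c y * E x y)"
  proof (intro sum_mono mult_right_mono nonneg)
    fix x y
    show "- (((c x)\<^sup>2 + (c y)\<^sup>2) / 2) \<le> c x * c y"
      using zero_le_power2[of "c x + c y"] by (simp add: power2_sum field_simps)
  qed
  finally have *: "- ?R \<le> (\<Sum>x\<in>F. \<Sum>y\<in>F. c x * c y * E x y)" .
  have "?R = (\<Sum>x\<in>F. (c x)\<^sup>2 * (\<Sum>y\<in>F. E x y))" by (simp add: sum_distrib_left)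
  also have "\<dots> \<le> (\<Sum>x\<in>F. (c x)\<^sup>2 * d)" by (intro sum_mono mult_left_mono row) auto
  also have "\<dots> = d * (\<Sum>x\<in>F. (c x)\<^sup>2)" by (simp add: sum_distrib_left mult.commute)
  finally have "?R \<le> d * (\<Sum>x\<in>F. (c x)\<^sup>2)" .
  with * show ?thesis by linarith
qed

section \<open>The sets of minimum degree\<close>

text \<open>
  Here \<open>\<mu> i\<close> is a lower bound for the degree of a union of two \<open>s\<close>-sets that meet in \<open>i\<close> points,
  so \<open>\<mu> s\<close> is one for the \<open>s\<close>-sets themselves. Indexing by the intersection size is what makes
  the expansion in the functions \<open>i \<mapsto> i choose j\<close> available. The sets attaining \<open>\<mu> s\<close> are singled out
  because the row sums of the excess \<open>E\<close> grow with the degree of \<open>S\<close>; for these sets they are at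
  most \<open>d\<close>.\<close>

lemma card_min_degree_sets_le_size:
  fixes \<mu> :: "nat \<Rightarrow> nat" and a :: "nat \<Rightarrow> int" and d :: int
  assumes "finite V" "card V = v"
    and blocks: "\<And>B. B \<in># \<B> \<Longrightarrow> B \<subseteq> V \<and> card B = k"
    and degree: "\<And>i X. i \<le> s \<Longrightarrow> X \<subseteq> V \<Longrightarrow> card X = 2 * s - i \<Longrightarrow> \<mu> i \<le> block_degree \<B> X"
    and expansion: "\<And>i. i \<le> s \<Longrightarrow> int (\<mu> i) = (\<Sum>j\<le>i. int (i choose j) * a j)"
    and a_nonneg: "\<And>j. j \<le> s \<Longrightarrow> 0 \<le> a j"
    and d: "d = int (\<mu> s) * (int (k choose s) - 1)
            - (\<Sum>i<s. int (s choose i) * int ((v - s) choose (s - i)) * int (\<mu> i))"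
    and "d < a s"
  shows "card {S \<in> subsets_of_size V s. block_degree \<B> S = \<mu> s} \<le> size \<B>"
proof -
  define P where "P = subsets_of_size V s"
  define F where "F = {S \<in> P. block_degree \<B> S = \<mu> s}"
  have finP: "finite P"
    unfolding P_def using \<open>finite V\<close> by (rule finite_subsets_of_size)
  have finF: "finite F" "F \<subseteq> P" using finP by (auto simp: F_def)
  have P: "finite S" "S \<subseteq> V" "card S = s" if "S \<in> P" for S
    using that assms(1) by (auto simp: P_def intro: finite_subset)
  have meet: "card (S \<inter> S') \<le> s" if "S \<in> P" for S S'
    using P[OF that] card_mono[of S "S \<inter> S'"] by auto
  define E where "E S S' = real (block_degree \<B> (S \<union> S')) - real (\<mu> (card (S \<inter> S')))" for S S'
  have E_nonneg: "0 \<le> E S S'" if "S \<in> P" "S' \<in> P" for S S'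
  proof -
    have "card (S \<union> S') = 2 * s - card (S \<inter> S')"
      using card_Un_Int[of S S'] P[OF that(1)] P[OF that(2)] by simp
    thus ?thesis
      using degree[OF meet[OF that(1)], of "S \<union> S'" S'] P[OF that(1)] P[OF that(2)]
      by (simp add: E_def)
  qed
  have row: "(\<Sum>S'\<in>F. E S S') \<le> real_of_int d" if "S \<in> F" for S
  proof -
    have S: "S \<in> P" "block_degree \<B> S = \<mu> s" using that by (auto simp: F_def)
    \<comment> \<open>The sum runs over all of \<open>P\<close>, not only \<open>F\<close>, so that both terms of \<open>E\<close> can be counted. It includes
        \<open>S' = S\<close>, where \<open>E\<close> is \<open>0\<close>; this is the summand \<open>i = s\<close>, which accounts for the \<open>- 1\<close>
        in \<open>d\<close>.\<close>
    have "(\<Sum>S'\<in>P. \<mu> (card (S \<inter> S'))) =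
          (\<Sum>i\<le>s. \<Sum>S' | S' \<in> P \<and> card (S \<inter> S') = i. \<mu> (card (S \<inter> S')))"
      by (rule sum.group [symmetric]) (use finP meet[OF S(1)] in auto)
    also have "\<dots> = (\<Sum>i\<le>s. (s choose i) * ((v - s) choose (s - i)) * \<mu> i)"
      using card_subsets_meeting[OF assms(1) P(2)[OF S(1)]] P(3)[OF S(1)] assms(2)
      by (intro sum.cong refl) (simp add: P_def)
    also have "\<dots> = (\<Sum>i<s. (s choose i) * ((v - s) choose (s - i)) * \<mu> i) + \<mu> s"
      by (simp add: lessThan_Suc_atMost [symmetric])
    finally have int_sum: "(\<Sum>S'\<in>P. real (\<mu> (card (S \<inter> S')))) =
        (\<Sum>i<s. real (s choose i) * real ((v - s) choose (s - i)) * real (\<mu> i)) + real (\<mu> s)"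
      by (simp flip: of_nat_sum of_nat_mult of_nat_add)
    have deg_sum: "(\<Sum>S'\<in>P. real (block_degree \<B> (S \<union> S'))) = real (\<mu> s) * real (k choose s)"
      using sum_block_degree_Un[OF assms(1) blocks, where S = S and s = s] S(2)
      by (simp add: P_def flip: of_nat_sum of_nat_mult)
    have "(\<Sum>S'\<in>F. E S S') \<le> (\<Sum>S'\<in>P. E S S')"
      using finF finP S(1) by (intro sum_mono2) (auto intro: E_nonneg)
    also have "\<dots> = real_of_int d"
      by (simp add: E_def sum_subtractf int_sum deg_sum d algebra_simps)
    finally show ?thesis .
  qed
  have "card F \<le> size \<B>"
  proof (rule card_le_size_of_positive_definite[OF finF(1)])
    fix c :: "'a set \<Rightarrow> real" assume "\<exists>S\<in>F. c S \<noteq> 0"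
    then obtain S where "S \<in> F" "c S \<noteq> 0" by blast
    hence "0 < (\<Sum>S\<in>F. (c S)\<^sup>2)" using finF(1) by (intro sum_pos2[of _ S]) auto
    hence "0 < (real_of_int (a s) - real_of_int d) * (\<Sum>S\<in>F. (c S)\<^sup>2)"
      using \<open>d < a s\<close> by simp
    also have "\<dots> = real_of_int (a s) * (\<Sum>S\<in>F. (c S)\<^sup>2) + - real_of_int d * (\<Sum>S\<in>F. (c S)\<^sup>2)"
      by (simp add: algebra_simps)
    also have "\<dots> \<le> (\<Sum>S\<in>F. \<Sum>S'\<in>F. c S * c S' *
          (\<Sum>j\<le>s. real (card (S \<inter> S') choose j) * real_of_int (a j))) +
        (\<Sum>S\<in>F. \<Sum>S'\<in>F. c S * c S' * E S S')"
    proof (rule add_mono)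
      show "real_of_int (a s) * (\<Sum>S\<in>F. (c S)\<^sup>2) \<le> (\<Sum>S\<in>F. \<Sum>S'\<in>F. c S * c S' *
          (\<Sum>j\<le>s. real (card (S \<inter> S') choose j) * real_of_int (a j)))"
        by (rule intersection_gram_form_lower_bound) (use finF P a_nonneg in auto)
      show "- real_of_int d * (\<Sum>S\<in>F. (c S)\<^sup>2) \<le> (\<Sum>S\<in>F. \<Sum>S'\<in>F. c S * c S' * E S S')"
      proof (rule nonneg_symmetric_form_lower_bound)
        show "E S S' = E S' S" for S S' by (simp add: E_def Un_commute Int_commute)
        show "0 \<le> E S S'" if "S \<in> F" "S' \<in> F" for S S'
          using that finF(2) by (auto intro: E_nonneg)
      qed (rule row)
    qed
    also have "\<dots> = (\<Sum>S\<in>F. \<Sum>S'\<in>F. c S * c S' * block_degree \<B> (S \<union> S'))"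
    proof -
      have "(\<Sum>j\<le>s. real (card (S \<inter> S') choose j) * real_of_int (a j)) + E S S' =
            real (block_degree \<B> (S \<union> S'))" if "S \<in> F" for S S'
      proof -
        let ?i = "card (S \<inter> S')"
        \<comment> \<open>The terms beyond \<open>?i\<close> vanish, so one range of summation serves all pairs.\<close>
        have "(\<Sum>j\<le>?i. real (?i choose j) * real_of_int (a j)) =
              (\<Sum>j\<le>s. real (?i choose j) * real_of_int (a j))"
          by (rule sum.mono_neutral_left) (use meet[of S S'] that finF in auto)
        moreover have "real (\<mu> ?i) = (\<Sum>j\<le>?i. real (?i choose j) * real_of_int (a j))"
          using arg_cong[OF expansion[of ?i], of real_of_int] meet[of S S'] that finF by auto
        ultimately show ?thesis by (simp add: E_def)
      qed
      thus ?thesis by (simp flip: sum.distrib distrib_left)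
    qed
    finally show "0 < (\<Sum>S\<in>F. \<Sum>S'\<in>F. c S * c S' * block_degree \<B> (S \<union> S'))" .
  qed
  thus ?thesis by (simp add: F_def P_def)
qed

section \<open>The lower bound for the covering number\<close>

theorem theorem6:
  fixes t v k lam s :: nat
    and b :: "nat \<Rightarrow> nat"
    and a :: "nat \<Rightarrow> int"
    and d :: int
  assumes "0 < t" "0 < v" "0 < k" "0 < lam" "0 < s"
    and "t < k" "k < v" "s \<le> t div 2"
    and "\<And>i. i \<in> {s..2*s} \<Longrightarrow> 0 < b i"
    and "schonheim_bound lam (v - 2*s) (k - 2*s) (t - 2*s) \<le> b (2*s)"
    and "b (2*s) \<le> covering_number lam (v - 2*s) (k - 2*s) (t - 2*s)"
    and "\<And>i. i \<in> {s..2*s-1} \<Longrightarrow> \<lceil>real (v - i) / real (k - i) * real (b (i + 1))\<rceil> \<le> int (b i)"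
    and "\<And>i. i \<in> {s..2*s-1} \<Longrightarrow> b i \<le> covering_number lam (v - i) (k - i) (t - i)"
    and "\<And>j. j \<in> {0..s} \<Longrightarrow>
           a j = (\<Sum>i=0..j. (-1) ^ (i + j) * int (j choose i) * int (b (2*s - i)))"
    and "\<And>j. j \<in> {0..s} \<Longrightarrow> 0 \<le> a j"
    and "d = int (b s) * (int (k choose s) - 1)
           - (\<Sum>i=0..s-1. int (s choose i) * int ((v - s) choose (s - i)) * int (b (2*s - i)))"
    and "d < a s"
  shows "int (covering_number lam v k t) \<ge>
           \<lceil>real ((v choose s) * (b s + 1)) / real ((k choose s) + 1)\<rceil>"
proof -
  define C where "C = covering_number lam v k t"
  define \<mu> where "\<mu> i = b (2 * s - i)" for i
  have two_s: "2 * s \<le> t" using assms(8) by simp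
  obtain V :: "nat set" and \<B> where cov: "is_covering t v k lam V \<B>" and size: "size \<B> = C"
    using covering_number_attained[of t k v lam] assms(1,6,7) by (auto simp: C_def)
  have V: "finite V" "card V = v" and blocks: "\<And>B. B \<in># \<B> \<Longrightarrow> B \<subseteq> V \<and> card B = k"
    using cov by (auto simp: is_covering_def incidence_structure_def)
  have b_le: "b i \<le> covering_number lam (v - i) (k - i) (t - i)" if "s \<le> i" "i \<le> 2 * s" for i
  proof (cases "i = 2 * s")
    case True
    show ?thesis unfolding True by (rule assms(11))
  next
    case False
    show ?thesis by (rule assms(13)) (use that False in simp)
  qed
  have degree: "b i \<le> block_degree \<B> X"
    if "s \<le> i" "i \<le> 2 * s" "X \<subseteq> V" "card X = i" for i X
    using b_le[OF that(1,2)] covering_number_le_block_degree[OF cov that(3,4)] that(2) two_s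
    by linarith
  have expansion: "int (\<mu> i) = (\<Sum>j\<le>i. int (i choose j) * a j)" if "i \<le> s" for i
    by (rule binomial_inversion[where f = "\<lambda>i. int (\<mu> i)"])
      (use that assms(14) in \<open>simp add: \<mu>_def\<close>)
  define P where "P = subsets_of_size V s"
  define F where "F = {S \<in> P. block_degree \<B> S = b s}"
  have "card {S \<in> subsets_of_size V s. block_degree \<B> S = \<mu> s} \<le> size \<B>"
  proof (rule card_min_degree_sets_le_size[OF V blocks, where a = a and d = d])
    show "\<mu> i \<le> block_degree \<B> X" if "i \<le> s" "X \<subseteq> V" "card X = 2 * s - i" for i X
      using degree[of "2 * s - i" X] that by (simp add: \<mu>_def)
    have "{0..s - 1} = {..<s}" using assms(5) by auto
    thus "d = int (\<mu> s) * (int (k choose s) - 1) -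
        (\<Sum>i<s. int (s choose i) * int ((v - s) choose (s - i)) * int (\<mu> i))"
      using assms(16) by (simp add: \<mu>_def)
  qed (use expansion assms(15,17) in auto)
  hence F_le: "card F \<le> C" by (simp add: F_def P_def \<mu>_def size)
  have finP: "finite P"
    unfolding P_def using V(1) by (rule finite_subsets_of_size)
  have "card P = v choose s" using n_subsets[OF V(1), of s] V(2) by (simp add: P_def)
  \<comment> \<open>Each \<open>S\<close> in \<open>F\<close> falls short of degree \<open>b s + 1\<close> by exactly one.\<close>
  hence "(v choose s) * (b s + 1) = (\<Sum>S\<in>P. b s + 1)" by simp
  also have "\<dots> \<le> (\<Sum>S\<in>P. block_degree \<B> S + of_bool (block_degree \<B> S = b s))"
  proof (rule sum_mono)
    fix S assume "S \<in> P"
    thus "b s + 1 \<le> block_degree \<B> S + of_bool (block_degree \<B> S = b s)"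
      using degree[of s S] by (auto simp: P_def)
  qed
  also have "\<dots> = (\<Sum>S\<in>P. block_degree \<B> S) + card F"
    using finP by (simp add: sum.distrib F_def of_bool_def sum.If_cases Int_def)
  also have "(\<Sum>S\<in>P. block_degree \<B> S) = C * (k choose s)"
    using sum_block_degree_Un[OF V(1) blocks, where S = "{}" and s = s] size
    by (simp add: P_def block_degree_def)
  also have "C * (k choose s) + card F \<le> C * ((k choose s) + 1)" using F_le by simp
  finally have "real ((v choose s) * (b s + 1)) \<le> real (C * ((k choose s) + 1))"
    by (rule of_nat_mono)
  hence "real ((v choose s) * (b s + 1)) / real ((k choose s) + 1) \<le> real_of_int (int C)"
    by (simp add: divide_le_eq algebra_simps)
  thus ?thesis unfolding C_def by (simp only: ceiling_le_iff)
qed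

end
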